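(* Let $\mathbb F$ be a non-archimedean (NA) valued field with trivial valuation, let $(X,d)$ be a (nonempty) ultra-metric space and let $\mathcal U(d)$ be the uniformity of $d$. Then the free NA locally convex space $L_{\mathbb F}(X,\mathcal U(d))$ is normable by the Kantorovich ultra-norm $\|\cdot\|_d$; that is, the topology of $L_{\mathbb F}(X,\mathcal U(d))$ is the one generated by the single ultra-norm $\|\cdot\|_d$ on $L_{\mathbb F}(X)$, where $d$ is extended to $\overline X=X\cup\{\mathbf 0\}$ by $d(x,\mathbf 0)=\max\{d(x,x_0),1\}$ for some fixed $x_0\in X$.
   Context: The trivial valuation is $|x|=1$ for all $x\neq 0$. An ultra-metric is a metric with $d(x,z)\le\max\{d(x,y),d(y,z)\}$. An ultra-seminorm on an $\mathbb F$-vector space is a map $p\ge0$ with $p(0)=0$, $p(x+y)\le\max\{p(x),p(y)\}$, $p(\alpha x)=|\alpha|p(x)$; it is an ultra-norm if $p(x)=0$ only for $x=0$. A uniform space is NA if its uniformity has a base of equivalence relations. An NA locally convex $\mathbb F$-space is a Hausdorff topological $\mathbb F$-vector space whose topology is generated by a family of ultra-seminorms; it carries its natural additive uniformity. $L_{\mathbb F}(X)$ is the free $\mathbb F$-vector space on $X$; $\mathbf 0\notin X$ is its zero vector, $\overline X:=X\cup\{\mathbf 0\}\subseteq L_{\mathbb F}(X)$. The Kantorovich ultra-(semi)norm $\|\cdot\|_d$ for an ultra-(pseudo)metric $d$ on $\overline X$ is the (pointwise) maximal ultra-seminorm $p$ on $L_{\mathbb F}(X)$ with $p(x-y)=d(x,y)$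 for all $x,y\in\overline X$; it exists, is an ultra-norm when $d$ is an ultra-metric, and is given by $\|u\|_d=\inf\{\max_{1\le i\le k}|s_i|d(a_i,b_i): u=\sum_{i=1}^k s_i(a_i-b_i),\ a_i,b_i\in\overline X,\ s_i\in\mathbb F\}$. The free NA locally convex $\mathbb F$-space $L_{\mathbb F}(X,\mathcal U)$ of a Hausdorff NA uniform space $(X,\mathcal U)$ is the NA locally convex $\mathbb F$-space with underlying vector space $L_{\mathbb F}(X)$ such that the canonical map $i:X\to L_{\mathbb F}(X)$ is uniformly continuous and for every uniformly continuous map $\varphi:(X,\mathcal U)\to V$ into an NA locally convex $\mathbb F$-space $V$ the unique linear extension $\Phi:L_{\mathbb F}(X,\mathcal U)\to V$ is continuous. It exists, and its topology is generated by the Kantorovich ultra-seminorms of all ultra-pseudometrics on $\overline X$ that are uniformly continuous for the uniformity obtained from $\mathcal U$ by adding $\mathbf 0$ as an isolated point. *)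

theory Defs
  imports "HOL-Analysis.Analysis" "HOL-Library.Poly_Mapping"
begin

section \<open>Non-archimedean valued fields\<close>

definition NA_valuation :: "('f::field \<Rightarrow> real) \<Rightarrow> bool" where
  "NA_valuation v \<longleftrightarrow>
     (\<forall>a. 0 \<le> v a) \<and> (\<forall>a. v a = 0 \<longleftrightarrow> a = 0) \<and>
     (\<forall>a b. v (a * b) = v a * v b) \<and> (\<forall>a b. v (a + b) \<le> max (v a) (v b))"

definition trivial_valuation :: "('f::field \<Rightarrow> real) \<Rightarrow> bool" where
  "trivial_valuation v \<longleftrightarrow> (\<forall>a. a \<noteq> 0 \<longrightarrow> v a = 1)"

definition valuation_topology :: "('f::field \<Rightarrow> real) \<Rightarrow> 'f topology" where
  "valuation_topology v = Metric_space.mtopology UNIV (\<lambda>a b. v (a - b))"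


section \<open>Ultra-seminorms and NA locally convex spaces\<close>

text \<open>
  A vector space over the field \<open>'f\<close> is a type \<open>'v\<close> of class \<open>ab_group_add\<close> together with an
  explicit scalar multiplication \<open>s\<close> (as in the library locale \<open>vector_space\<close>).
\<close>

definition ultra_seminorm ::
    "('f::field \<Rightarrow> real) \<Rightarrow> ('f \<Rightarrow> 'v::ab_group_add \<Rightarrow> 'v) \<Rightarrow> ('v \<Rightarrow> real) \<Rightarrow> bool" where
  "ultra_seminorm v s p \<longleftrightarrow>
     (\<forall>x. 0 \<le> p x) \<and> p 0 = 0 \<and>
     (\<forall>x y. p (x + y) \<le> max (p x) (p y)) \<and> (\<forall>a x. p (s a x) = v a * p x)"

definition ultra_norm ::
    "('f::field \<Rightarrow> real) \<Rightarrow> ('f \<Rightarrow> 'v::ab_group_add \<Rightarrow> 'v) \<Rightarrow> ('v \<Rightarrow> real) \<Rightarrow> bool" where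
  "ultra_norm v s p \<longleftrightarrow> ultra_seminorm v s p \<and> (\<forall>x. p x = 0 \<longrightarrow> x = 0)"

text \<open>
  The whole space is put into the subbase so that the empty family generates the
  indiscrete topology on the whole type.
\<close>

definition seminorm_topology :: "('v::ab_group_add \<Rightarrow> real) set \<Rightarrow> 'v topology" where
  "seminorm_topology P =
     topology_generated_by (insert UNIV {{y. p (y - x) < e} | p x e. p \<in> P \<and> e > 0})"

definition topological_vector_space ::
    "('f::field \<Rightarrow> real) \<Rightarrow> ('f \<Rightarrow> 'v::ab_group_add \<Rightarrow> 'v) \<Rightarrow> 'v topology \<Rightarrow> bool" where
  "topological_vector_space v s T \<longleftrightarrow>
     vector_space s \<and> topspace T = UNIV \<and>
     continuous_map (prod_topology T T) T (\<lambda>(x, y). x + y) \<and>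
     continuous_map (prod_topology (valuation_topology v) T) T (\<lambda>(a, x). s a x)"

definition NA_locally_convex_space ::
    "('f::field \<Rightarrow> real) \<Rightarrow> ('f \<Rightarrow> 'v::ab_group_add \<Rightarrow> 'v) \<Rightarrow> 'v topology \<Rightarrow> bool" where
  "NA_locally_convex_space v s T \<longleftrightarrow>
     topological_vector_space v s T \<and> Hausdorff_space T \<and>
     (\<exists>P. (\<forall>p\<in>P. ultra_seminorm v s p) \<and> T = seminorm_topology P)"


section \<open>Uniformities\<close>

text \<open>
  Uniformities are filters on \<open>'a \<times> 'a\<close>, as in the library class \<open>uniform_space\<close>.
  A filter with a base of equivalence relations is automatically a uniformity.
\<close>

definition Hausdorff_NA_uniformity :: "('a \<times> 'a) filter \<Rightarrow> bool" where
  "Hausdorff_NA_uniformity U \<longleftrightarrow>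
     (\<forall>E. eventually E U \<longrightarrow>
        (\<exists>R. equiv UNIV R \<and> eventually (\<lambda>z. z \<in> R) U \<and> (\<forall>z\<in>R. E z))) \<and>
     (\<forall>x y. x \<noteq> y \<longrightarrow> (\<exists>E. eventually E U \<and> \<not> E (x, y)))"

definition additive_uniformity :: "'v::ab_group_add topology \<Rightarrow> ('v \<times> 'v) filter" where
  "additive_uniformity T = filtercomap (\<lambda>(x, y). x - y) (nhdsin T 0)"

definition uniformly_continuous_map ::
    "('a \<times> 'a) filter \<Rightarrow> ('b \<times> 'b) filter \<Rightarrow> ('a \<Rightarrow> 'b) \<Rightarrow> bool" where
  "uniformly_continuous_map U W f \<longleftrightarrow> (LIM (x, y) U. (f x, f y) :> W)"


section \<open>The free vector space and the free NA locally convex space\<close>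

text \<open>
  The free vector space on \<open>X = (UNIV :: 'a set)\<close> is the type \<open>'a \<Rightarrow>\<^sub>0 'f\<close> of finitely supported
  functions, with the following scalar multiplication and canonical map.
\<close>

definition free_scale :: "'f::field \<Rightarrow> ('a \<Rightarrow>\<^sub>0 'f) \<Rightarrow> ('a \<Rightarrow>\<^sub>0 'f)" where
  "free_scale c u = Poly_Mapping.map (\<lambda>b. c * b) u"

definition free_gen :: "'a \<Rightarrow> ('a \<Rightarrow>\<^sub>0 'f::field)" where
  "free_gen x = Poly_Mapping.single x 1"

lemma lookup_free_scale: "Poly_Mapping.lookup (free_scale c u) x = c * Poly_Mapping.lookup u x"
  by (simp add: free_scale_def Poly_Mapping.map.rep_eq when_def)

lemma vector_space_free_scale: "vector_space (free_scale :: 'f::field \<Rightarrow> ('a \<Rightarrow>\<^sub>0 'f) \<Rightarrow> _)"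
  by unfold_locales
    (auto intro!: poly_mapping_eqI simp: lookup_free_scale lookup_add algebra_simps)

text \<open>
  \<open>free_NA_lcs TYPE('v) v U T\<close>: the topology \<open>T\<close> on the free vector space makes it the free NA
  locally convex space of \<open>U\<close>, the test spaces of the universal property being all NA locally
  convex spaces carried by the type \<open>'v\<close>.  A definition cannot quantify over types, so \<open>'v\<close>
  is a parameter: a theorem \<open>free_NA_lcs TYPE('v) v U T\<close> with free \<open>'v\<close> asserts
  the universal property for all test spaces.
\<close>

definition free_NA_lcs ::
    "'v::ab_group_add itself \<Rightarrow> ('f::field \<Rightarrow> real) \<Rightarrow> ('a \<times> 'a) filter \<Rightarrow>
     ('a \<Rightarrow>\<^sub>0 'f) topology \<Rightarrow> bool" where
  "free_NA_lcs V v U T \<longleftrightarrow>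
     Hausdorff_NA_uniformity U \<and>
     NA_locally_convex_space v free_scale T \<and>
     uniformly_continuous_map U (additive_uniformity T) free_gen \<and>
     (\<forall>(s :: 'f \<Rightarrow> 'v \<Rightarrow> 'v) S \<phi>.
        NA_locally_convex_space v s S \<longrightarrow>
        uniformly_continuous_map U (additive_uniformity S) \<phi> \<longrightarrow>
        (\<exists>!\<Phi>. Vector_Spaces.linear free_scale s \<Phi> \<and> (\<forall>x. \<Phi> (free_gen x) = \<phi> x) \<and>
              continuous_map T S \<Phi>))"


section \<open>The Kantorovich ultra-seminorm\<close>

text \<open>
  \<open>'a option\<close> stands for the set \<open>X \<union> {0}\<close> inside the free vector space: \<open>None\<close> is the zero
  vector and \<open>Some x\<close> the generator \<open>x\<close>.
\<close>

fun free_emb :: "'a option \<Rightarrow> ('a \<Rightarrow>\<^sub>0 'f::field)" where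
  "free_emb None = 0"
| "free_emb (Some x) = free_gen x"

text \<open>The greatest element is taken in the pointwise order of real-valued functions.\<close>

definition kantorovich ::
    "('f::field \<Rightarrow> real) \<Rightarrow> ('a option \<Rightarrow> 'a option \<Rightarrow> real) \<Rightarrow> ('a \<Rightarrow>\<^sub>0 'f) \<Rightarrow> real" where
  "kantorovich v d =
     (GREATEST p. ultra_seminorm v free_scale p \<and>
                  (\<forall>x y. p (free_emb x - free_emb y) = d x y))"

fun extended_dist :: "('a \<Rightarrow> 'a \<Rightarrow> real) \<Rightarrow> 'a \<Rightarrow> 'a option \<Rightarrow> 'a option \<Rightarrow> real" where
  "extended_dist d x0 None None = 0"
| "extended_dist d x0 (Some x) None = max (d x x0) 1"
| "extended_dist d x0 None (Some y) = max (d y x0) 1"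
| "extended_dist d x0 (Some x) (Some y) = d x y"

end

(*
  Since the valuation is trivial, for every linear subspace A and every r >= 0 the function that is
  0 on A and r off A is an ultra-seminorm.  The Kantorovich ultra-seminorm is the pointwise supremum
  of all ultra-seminorms p with p(x - y) <= d(x, y), so it dominates each such step function that
  satisfies this bound.  Kernels of the functionals "sum of the coefficients over a ball" show that
  the supremum restricts to d and separates points; the subspaces {u. q(Phi u) < e} show that the
  linear extension Phi of a uniformly continuous map is continuous.
*)
theory Submission
  imports Defs
begin

section \<open>Linear extension\<close>

definition free_lift :: "('f::field \<Rightarrow> 'v::ab_group_add \<Rightarrow> 'v) \<Rightarrow> ('a \<Rightarrow> 'v) \<Rightarrow> ('a \<Rightarrow>\<^sub>0 'f) \<Rightarrow> 'v" where
  "free_lift s \<phi> u = (\<Sum>x\<in>Poly_Mapping.keys u. s (Poly_Mapping.lookup u x) (\<phi> x))"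

text \<open>Vectors with different supports are compared through sums over a common finite set;
  points outside the support contribute 0.\<close>

lemma free_lift_superset:
  assumes "vector_space s" "finite A" "Poly_Mapping.keys u \<subseteq> A"
  shows "free_lift s \<phi> u = (\<Sum>x\<in>A. s (Poly_Mapping.lookup u x) (\<phi> x))"
proof -
  interpret vector_space s by fact
  show ?thesis unfolding free_lift_def
    using assms by (intro sum.mono_neutral_left) (auto simp: in_keys_iff)
qed

lemma linear_free_lift:
  assumes "vector_space s"
  shows "Vector_Spaces.linear free_scale s (free_lift s \<phi>)"
proof -
  interpret F: vector_space free_scale by (rule vector_space_free_scale)
  interpret V: vector_space s by fact
  have "free_lift s \<phi> (u + w) = free_lift s \<phi> u + free_lift s \<phi> w" for u w
  proof -
    let ?A = "Poly_Mapping.keys u \<union> Poly_Mapping.keys w"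
    have "free_lift s \<phi> z = (\<Sum>x\<in>?A. s (Poly_Mapping.lookup z x) (\<phi> x))"
      if "z \<in> {u, w, u + w}" for z
      using that keys_add[of u w] by (intro free_lift_superset assms) auto
    then show ?thesis
      by (simp add: lookup_add V.scale_left_distrib sum.distrib)
  qed
  moreover have "free_lift s \<phi> (free_scale c u) = s c (free_lift s \<phi> u)" for c u
  proof -
    have "free_lift s \<phi> (free_scale c u)
        = (\<Sum>x\<in>Poly_Mapping.keys u. s (Poly_Mapping.lookup (free_scale c u) x) (\<phi> x))"
      by (intro free_lift_superset assms) (auto simp: in_keys_iff lookup_free_scale)
    then show ?thesis
      by (simp add: free_lift_def lookup_free_scale V.scale_sum_right)
  qed
  ultimately show ?thesis
    by unfold_locales auto
qed

lemma free_lift_gen: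
  assumes "vector_space s"
  shows "free_lift s \<phi> (free_gen x) = \<phi> x"
proof -
  interpret vector_space s by fact
  show ?thesis by (simp add: free_lift_def free_gen_def)
qed

text \<open>This is the expansion of a vector in the generators; uniqueness of linear extensions and
  the bound on subextensions rest on it.\<close>

lemma free_lift_free_gen: "free_lift free_scale free_gen u = u"
proof (rule poly_mapping_eqI)
  fix y
  have "Poly_Mapping.lookup (free_lift free_scale free_gen u) y
      = (\<Sum>x\<in>Poly_Mapping.keys u. if x = y then Poly_Mapping.lookup u x else 0)"
    unfolding free_lift_def lookup_sum
    by (intro sum.cong) (auto simp: lookup_free_scale free_gen_def lookup_single)
  then show "Poly_Mapping.lookup (free_lift free_scale free_gen u) y = Poly_Mapping.lookup u y"
    by (simp add: in_keys_iff)
qed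

lemma linear_eq_free_lift:
  assumes "Vector_Spaces.linear free_scale s \<Phi>" "\<And>x. \<Phi> (free_gen x) = \<phi> x"
  shows "\<Phi> = free_lift s \<phi>"
proof
  interpret Vector_Spaces.linear free_scale s \<Phi> by fact
  fix u
  have "\<Phi> u = \<Phi> (free_lift free_scale free_gen u)"
    by (simp add: free_lift_free_gen)
  also have "\<dots> = free_lift s \<phi> u"
    by (simp add: free_lift_def sum scale assms(2))
  finally show "\<Phi> u = free_lift s \<phi> u" .
qed

section \<open>Ultra-seminorms over a trivially valued field\<close>

text \<open>Since \<open>v (-1)\<close> is nonnegative with square \<open>v 1 = 1\<close>, it equals
  1, and homogeneity at the scalar -1 applies.\<close>

lemma ultra_seminorm_minus:
  assumes "NA_valuation v" "vector_space s" "ultra_seminorm v s p"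
  shows "p (- x) = p x"
proof -
  interpret vector_space s by fact
  have "v (-1) * v (-1) = 1 * 1" "v 1 * v 1 = v 1" "v 1 \<noteq> 0" "0 \<le> v (-1)"
    using assms(1) unfolding NA_valuation_def
    by (metis mult_1 mult_minus1 minus_minus one_neq_zero mult_cancel_right2)+
  then have "v (-1) = 1"
    by (metis mult_1 power2_eq_square power2_eq_iff_nonneg zero_le_one)
  moreover have "p (s (-1) x) = v (-1) * p x"
    using assms(3) unfolding ultra_seminorm_def by blast
  ultimately show ?thesis by simp
qed

text \<open>The strong triangle inequality loses no radius, so the arguments below keep the same
  \<open>e\<close> where an ordinary seminorm would need halving.\<close>

lemma ultra_seminorm_diff_less:
  assumes "ultra_seminorm v s p" "p (a - b) < e" "p (b - c) < e"
  shows "p (a - c) < e"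
proof -
  have "p ((a - b) + (b - c)) \<le> max (p (a - b)) (p (b - c))"
    using assms(1) unfolding ultra_seminorm_def by blast
  then show ?thesis using assms by simp
qed

lemma trivial_valuation_le_1:
  assumes "NA_valuation v" "trivial_valuation v"
  shows "v a \<le> 1"
  using assms unfolding NA_valuation_def trivial_valuation_def
  by (cases "a = 0") (metis zero_le_one, simp)

lemma ultra_seminorm_scale_le:
  assumes "NA_valuation v" "trivial_valuation v" "ultra_seminorm v s p"
  shows "p (s a x) \<le> p x"
  using assms(3) mult_right_mono[OF trivial_valuation_le_1[OF assms(1,2)], of "p x" a]
  by (simp add: ultra_seminorm_def)

text \<open>A nonzero scalar moves no vector into or out of \<open>A\<close> and has absolute value
  1, which gives homogeneity. A sum outside \<open>A\<close> has a summand outside \<open>A\<close>,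
  which gives the strong triangle inequality.\<close>

lemma ultra_seminorm_step:
  assumes "NA_valuation v" "trivial_valuation v" "vector_space s"
    and "module.subspace s A" "0 \<le> r"
  shows "ultra_seminorm v s (\<lambda>u. if u \<in> A then 0 else r)"
proof -
  interpret vector_space s by fact
  have v: "v 0 = 0" "\<And>a. a \<noteq> 0 \<Longrightarrow> v a = 1"
    using assms(1,2) by (auto simp: NA_valuation_def trivial_valuation_def)
  have "s a x \<in> A \<longleftrightarrow> x \<in> A" if "a \<noteq> 0" for a x
    using subspace_scale[OF assms(4), of x a] subspace_scale[OF assms(4), of "s a x" "inverse a"] that
    by auto
  then have "(if s a x \<in> A then 0 else r) = v a * (if x \<in> A then 0 else r)" for a x
    using v subspace_0[OF assms(4)] by (cases "a = 0") auto
  then show ?thesis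
    using assms(5) subspace_0[OF assms(4)] subspace_add[OF assms(4)]
    unfolding ultra_seminorm_def by auto
qed

text \<open>A ball about 0 is closed under sums by the strong triangle inequality and under all
  scalars because their absolute values are at most 1.\<close>

lemma subspace_ultra_seminorm_less:
  assumes "NA_valuation v" "trivial_valuation v" "ultra_seminorm v s q" "0 < e"
    and "Vector_Spaces.linear t s \<Phi>"
  shows "module.subspace t {u. q (\<Phi> u) < e}"
proof -
  interpret Vector_Spaces.linear t s \<Phi> by fact
  have "q (\<Phi> x + \<Phi> y) < e" if "q (\<Phi> x) < e" "q (\<Phi> y) < e" for x y
    using that assms(3) unfolding ultra_seminorm_def by (meson le_less_trans max_less_iff_conj)
  moreover have "q (s c (\<Phi> x)) < e" if "q (\<Phi> x) < e" for c x
    using that ultra_seminorm_scale_le[OF assms(1-3)] le_less_trans by blast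
  ultimately show ?thesis
    using assms(3,4) by (simp add: vs1.subspace_def add scale zero ultra_seminorm_def)
qed

section \<open>Topologies generated by ultra-seminorms\<close>

lemma topspace_seminorm_topology [simp]: "topspace (seminorm_topology P) = UNIV"
  by (simp add: seminorm_topology_def)

lemma openin_seminorm_ball:
  "p \<in> P \<Longrightarrow> 0 < e \<Longrightarrow> openin (seminorm_topology P) {y. p (y - x) < e}"
  unfolding seminorm_topology_def by (rule topology_generated_by_Basis) blast

text \<open>Every point of an ultra-seminorm ball is a centre of it, so the subbasic balls have the
  property on the right; finite intersections and unions inherit it.\<close>

lemma openin_seminorm_topology_singleton:
  assumes "ultra_seminorm v s p"
  shows "openin (seminorm_topology {p}) U \<longleftrightarrow> (\<forall>x\<in>U. \<exists>e>0. \<forall>y. p (y - x) < e \<longrightarrow> y \<in> U)"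
proof
  assume "openin (seminorm_topology {p}) U"
  then have "generate_topology_on (insert UNIV {{y. p (y - x) < e} | p' x e. p' \<in> {p} \<and> e > 0}) U"
    unfolding seminorm_topology_def openin_topology_generated_by_iff by simp
  then show "\<forall>x\<in>U. \<exists>e>0. \<forall>y. p (y - x) < e \<longrightarrow> y \<in> U"
  proof induction
    case Empty
    then show ?case by simp
  next
    case (Int a b)
    show ?case
    proof
      fix x assume "x \<in> a \<inter> b"
      with Int.IH obtain e1 e2 where "e1 > 0" "e2 > 0" "\<forall>y. p (y - x) < e1 \<longrightarrow> y \<in> a"
        "\<forall>y. p (y - x) < e2 \<longrightarrow> y \<in> b"
        by blast
      then show "\<exists>e>0. \<forall>y. p (y - x) < e \<longrightarrow> y \<in> a \<inter> b"
        by (intro exI[of _ "min e1 e2"]) auto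
    qed
  next
    case (UN K)
    then show ?case by (meson Union_iff)
  next
    case (Basis U)
    then consider "U = UNIV" | z e where "U = {y. p (y - z) < e}" "e > 0"
      by blast
    then show ?case
    proof cases
      case 1
      then show ?thesis by (auto intro: zero_less_one)
    next
      case 2
      then show ?thesis using ultra_seminorm_diff_less[OF assms] by blast
    qed
  qed
next
  assume U: "\<forall>x\<in>U. \<exists>e>0. \<forall>y. p (y - x) < e \<longrightarrow> y \<in> U"
  show "openin (seminorm_topology {p}) U"
  proof (subst openin_subopen, intro ballI)
    fix x assume "x \<in> U"
    with U obtain e where "e > 0" "\<forall>y. p (y - x) < e \<longrightarrow> y \<in> U" by blast
    moreover have "p (x - x) = 0" using assms by (simp add: ultra_seminorm_def)
    ultimately show "\<exists>T. openin (seminorm_topology {p}) T \<and> x \<in> T \<and> T \<subseteq> U"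
      using openin_seminorm_ball[of p "{p}" e x]
      by (intro exI[of _ "{y. p (y - x) < e}"]) auto
  qed
qed

lemma continuous_map_into_seminorm_topology:
  assumes "\<And>p z e. p \<in> P \<Longrightarrow> 0 < e \<Longrightarrow> openin T {x \<in> topspace T. p (f x - z) < e}"
  shows "continuous_map T (seminorm_topology P) f"
  unfolding seminorm_topology_def
proof (rule continuous_on_generated_topo)
  fix U assume "U \<in> insert UNIV {{y. p (y - x) < e} | p x e. p \<in> P \<and> e > 0}"
  then consider "U = UNIV" | p x e where "U = {y. p (y - x) < e}" "p \<in> P" "e > 0"
    by blast
  then show "openin T (f -` U \<inter> topspace T)"
  proof cases
    case 2
    have "f -` U \<inter> topspace T = {y \<in> topspace T. p (f y - x) < e}"
      using 2 by auto
    then show ?thesis using assms 2 by simp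
  qed simp
qed auto

text \<open>Distinct scalars are at distance 1, so balls of radius 1/2 are singletons.\<close>

lemma openin_valuation_topology_trivial:
  assumes "NA_valuation v" "trivial_valuation v"
  shows "openin (valuation_topology v) U"
proof -
  have v: "v a = (if a = 0 then 0 else 1)" for a
    using assms by (auto simp: NA_valuation_def trivial_valuation_def)
  interpret Metric_space UNIV "\<lambda>a b. v (a - b)"
    by unfold_locales (auto simp: v)
  have "y = x" if "v (x - y) < 1/2" for x y
    using that by (simp add: v split: if_splits)
  then have "mball x (1/2) \<subseteq> {x}" for x
    unfolding subset_iff in_mball by blast
  then show ?thesis
    unfolding valuation_topology_def openin_mtopology
    by (metis empty_subsetI half_gt_zero insert_subset subset_UNIV subset_trans zero_less_one)
qed

lemma topological_vector_space_seminorm_topology: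
  assumes "NA_valuation v" "trivial_valuation v" "vector_space s"
    and P: "\<And>p. p \<in> P \<Longrightarrow> ultra_seminorm v s p"
  shows "topological_vector_space v s (seminorm_topology P)"
proof -
  interpret vector_space s by fact
  let ?T = "seminorm_topology P"
  have p0: "p (x - x) = 0" if "p \<in> P" for p x
    using P[OF that] by (simp add: ultra_seminorm_def)
  have add: "continuous_map (prod_topology ?T ?T) ?T (\<lambda>(x, y). x + y)"
  proof (rule continuous_map_into_seminorm_topology)
    fix p z e assume p: "p \<in> P" and e: "(0::real) < e"
    have "\<exists>U V. openin ?T U \<and> openin ?T V \<and> a \<in> U \<and> b \<in> V \<and> U \<times> V \<subseteq> {(x, y). p (x + y - z) < e}"
      if ab: "p (a + b - z) < e" for a b
    proof (intro exI conjI)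
      show "{y. p (y - a) < e} \<times> {y. p (y - b) < e} \<subseteq> {(x, y). p (x + y - z) < e}"
      proof clarify
        fix x y assume "p (x - a) < e" "p (y - b) < e"
        then have "p ((x + y) - (a + y)) < e" "p ((a + y) - (a + b)) < e" by simp_all
        then show "p (x + y - z) < e"
          using ab ultra_seminorm_diff_less[OF P[OF p]] by blast
      qed
    qed (use p e p0[OF p] openin_seminorm_ball in auto)
    then show "openin (prod_topology ?T ?T)
        {x \<in> topspace (prod_topology ?T ?T). p ((case x of (x, y) \<Rightarrow> x + y) - z) < e}"
      unfolding openin_prod_topology_alt by (auto simp: case_prod_unfold)
  qed
  have scale: "continuous_map (prod_topology (valuation_topology v) ?T) ?T (\<lambda>(a, x). s a x)"
  proof (rule continuous_map_into_seminorm_topology)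
    fix p z e assume p: "p \<in> P" and e: "(0::real) < e"
    have "\<exists>U V. openin (valuation_topology v) U \<and> openin ?T V \<and> a \<in> U \<and> b \<in> V \<and>
        U \<times> V \<subseteq> {(x, y). p (s x y - z) < e}"
      if ab: "p (s a b - z) < e" for a b
    proof (intro exI conjI)
      \<comment> \<open>The scalars are discrete, so the scalar may be frozen at \<open>a\<close>
        while only the vector varies.\<close>
      show "{a} \<times> {y. p (y - b) < e} \<subseteq> {(x, y). p (s x y - z) < e}"
      proof clarify
        fix y assume "p (y - b) < e"
        then have "p (s a y - s a b) < e"
          using ultra_seminorm_scale_le[OF assms(1,2) P[OF p], of a "y - b"]
          by (simp add: scale_right_diff_distrib)
        then show "p (s a y - z) < e"
          using ab ultra_seminorm_diff_less[OF P[OF p]] by blast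
      qed
    qed (use p e p0[OF p] openin_seminorm_ball openin_valuation_topology_trivial[OF assms(1,2)] in auto)
    moreover have "topspace (valuation_topology v) = UNIV"
      using openin_subset[OF openin_valuation_topology_trivial[OF assms(1,2)], of UNIV] by auto
    ultimately show "openin (prod_topology (valuation_topology v) ?T)
        {x \<in> topspace (prod_topology (valuation_topology v) ?T).
           p ((case x of (a, x) \<Rightarrow> s a x) - z) < e}"
      unfolding openin_prod_topology_alt by (auto simp: case_prod_unfold)
  qed
  show ?thesis
    unfolding topological_vector_space_def using assms(3) add scale by simp
qed

lemma NA_locally_convex_space_ultra_norm:
  assumes "NA_valuation v" "trivial_valuation v" "vector_space s" "ultra_norm v s p"
  shows "NA_locally_convex_space v s (seminorm_topology {p})"
proof -
  have p: "ultra_seminorm v s p" using assms(4) by (simp add: ultra_norm_def)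
  have "\<exists>U V. openin (seminorm_topology {p}) U \<and> openin (seminorm_topology {p}) V \<and>
      x \<in> U \<and> y \<in> V \<and> disjnt U V" if "x \<noteq> y" for x y
  proof (intro exI conjI)
    have pos: "0 < p (x - y)"
      using assms(4) that unfolding ultra_norm_def ultra_seminorm_def
      by (metis less_eq_real_def right_minus_eq)
    show "openin (seminorm_topology {p}) {z. p (z - x) < p (x - y)}"
      "openin (seminorm_topology {p}) {z. p (z - y) < p (x - y)}"
      using pos by (simp_all add: openin_seminorm_ball)
    show "x \<in> {z. p (z - x) < p (x - y)}" "y \<in> {z. p (z - y) < p (x - y)}"
      using pos p by (simp_all add: ultra_seminorm_def)
    \<comment> \<open>A common point \<open>z\<close> of the two balls would give
      \<open>p (x - y) < p (x - y)\<close>.\<close>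
    have "False" if "p (z - x) < p (x - y)" "p (z - y) < p (x - y)" for z
      using ultra_seminorm_diff_less[OF p, of x z _ y] that
        ultra_seminorm_minus[OF assms(1,3) p, of "z - x"] by fastforce
    then show "disjnt {z. p (z - x) < p (x - y)} {z. p (z - y) < p (x - y)}"
      by (auto simp: disjnt_def)
  qed
  then have "Hausdorff_space (seminorm_topology {p})"
    by (simp add: Hausdorff_space_def)
  moreover have "topological_vector_space v s (seminorm_topology {p})"
    using assms p by (intro topological_vector_space_seminorm_topology) auto
  ultimately show ?thesis
    unfolding NA_locally_convex_space_def using p by blast
qed

section \<open>The Kantorovich ultra-norm\<close>

locale pointed_ultrametric =
  fixes D :: "'a option \<Rightarrow> 'a option \<Rightarrow> real"
  assumes refl: "D x x = 0"
    and pos: "x \<noteq> y \<Longrightarrow> 0 < D x y"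
    and sym: "D x y = D y x"
    and ultra: "D x z \<le> max (D x y) (D y z)"
begin

lemma nonneg: "0 \<le> D x y"
  using pos[of x y] refl[of x] by (cases "x = y") auto

text \<open>Requiring \<open>\<le>\<close> in place of equality admits the two-valued step
  functions, which in general do not reproduce \<open>D\<close> on all pairs; the supremum of all
  members does.\<close>

definition subextensions :: "('f::field \<Rightarrow> real) \<Rightarrow> (('a \<Rightarrow>\<^sub>0 'f) \<Rightarrow> real) set" where
  "subextensions v =
     {p. ultra_seminorm v free_scale p \<and> (\<forall>x y. p (free_emb x - free_emb y) \<le> D x y)}"

text \<open>The right side does not depend on \<open>p\<close>, so suprema over
  \<open>subextensions v\<close> are genuine real numbers. A generator is its own difference from
  the zero vector, hence \<open>p\<close> is at most \<open>D (Some x) None\<close> on it.\<close>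

lemma subextension_bound:
  assumes "NA_valuation v" "p \<in> subextensions v"
  shows "p u \<le> (\<Sum>x\<in>Poly_Mapping.keys u. v (Poly_Mapping.lookup u x) * D (Some x) None)"
proof -
  have p: "ultra_seminorm v free_scale p" and le: "\<And>x y. p (free_emb x - free_emb y) \<le> D x y"
    using assms(2) by (auto simp: subextensions_def)
  have sum_le: "p (sum f A) \<le> (\<Sum>x\<in>A. p (f x))" if "finite A" for f and A :: "'a set"
    using that
  proof induction
    case empty
    then show ?case using p by (simp add: ultra_seminorm_def)
  next
    case (insert x A)
    have "p (f x + sum f A) \<le> max (p (f x)) (p (sum f A))" "0 \<le> p (f x)" "0 \<le> p (sum f A)"
      using p unfolding ultra_seminorm_def by blast+
    then show ?case using insert by simp
  qed
  have "p u = p (free_lift free_scale free_gen u)"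
    by (simp add: free_lift_free_gen)
  also have "\<dots> \<le> (\<Sum>x\<in>Poly_Mapping.keys u. p (free_scale (Poly_Mapping.lookup u x) (free_gen x)))"
    unfolding free_lift_def by (rule sum_le) simp
  also have "\<dots> = (\<Sum>x\<in>Poly_Mapping.keys u. v (Poly_Mapping.lookup u x) * p (free_gen x))"
    using p by (simp add: ultra_seminorm_def)
  also have "\<dots> \<le> (\<Sum>x\<in>Poly_Mapping.keys u. v (Poly_Mapping.lookup u x) * D (Some x) None)"
    using assms(1) le[of "Some _" None]
    by (intro sum_mono mult_left_mono) (auto simp: NA_valuation_def)
  finally show ?thesis .
qed

lemma bdd_above_subextensions:
  assumes "NA_valuation v"
  shows "bdd_above ((\<lambda>p. p u) ` subextensions v)"
  using subextension_bound[OF assms] by (intro bdd_aboveI2)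

text \<open>A pair with \<open>r \<le> D x y\<close> satisfies the bound because the step has height
  \<open>r\<close>; a closer pair does because its difference lies in \<open>A\<close>, where the
  step is 0.\<close>

lemma step_in_subextensions:
  assumes "NA_valuation v" "trivial_valuation v" "module.subspace free_scale A" "0 \<le> r"
    and "\<And>x y. D x y < r \<Longrightarrow> free_emb x - free_emb y \<in> A"
  shows "(\<lambda>u. if u \<in> A then 0 else r) \<in> subextensions v"
proof -
  have "(if free_emb x - free_emb y \<in> A then 0 else r) \<le> D x y" for x y
    using assms(5)[of x y] nonneg[of x y] by fastforce
  then show ?thesis
    using ultra_seminorm_step[OF assms(1,2) vector_space_free_scale assms(3,4)]
    by (simp add: subextensions_def)
qed

text \<open>Without the condition on \<open>None\<close>, the functional below would not see the zero vector
  as a point of the ball.\<close>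

lemma ball_functional:
  fixes a :: 'a and r :: real
  defines "f \<equiv> free_lift (*) (\<lambda>x. if D (Some x) (Some a) < r then 1 else 0 :: 'f::field)"
  assumes "NA_valuation v" "trivial_valuation v" "r \<le> D (Some a) None" "0 \<le> r"
  shows "(\<lambda>u. if f u = 0 then 0 else r) \<in> subextensions v"
    and "f (free_emb z) = (if D z (Some a) < r then 1 else 0)"
proof -
  have vs: "vector_space ((*) :: 'f \<Rightarrow> _)"
    by unfold_locales (auto simp: algebra_simps)
  interpret f: Vector_Spaces.linear free_scale "(*)" f
    unfolding f_def by (rule linear_free_lift[OF vs])
  show emb: "f (free_emb z) = (if D z (Some a) < r then 1 else 0)" for z
  proof (cases z)
    case None
    then show ?thesis using assms(4) sym[of None "Some a"] by (simp add: f.zero)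
  next
    case (Some b)
    then show ?thesis by (simp add: f_def free_lift_gen[OF vs])
  qed
  \<comment> \<open>A ball of radius \<open>r\<close> contains both or neither of two points closer
    than \<open>r\<close>, so the functional kills their difference.\<close>
  have iff: "D x (Some a) < r \<longleftrightarrow> D y (Some a) < r" if "D x y < r" for x y
    using that ultra[of x "Some a" y] ultra[of y "Some a" x] sym[of x y] by auto
  have "(\<lambda>u. if u \<in> {u. f u = 0} then 0 else r) \<in> subextensions v"
    using assms(5) iff emb
    by (intro step_in_subextensions assms(2,3) f.subspace_kernel) (auto simp: f.diff)
  then show "(\<lambda>u. if f u = 0 then 0 else r) \<in> subextensions v"
    by simp
qed

text \<open>The ball of radius \<open>D x y\<close> around one of two distinct points omits the
  other, so its functional is nonzero on their difference, where the step takes the value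
  \<open>D x y\<close>.\<close>

lemma subextension_attains:
  assumes "NA_valuation v" "trivial_valuation v"
  shows "\<exists>p\<in>subextensions (v :: 'f::field \<Rightarrow> real). D x y \<le> p (free_emb x - free_emb y)"
proof -
  interpret F: vector_space "free_scale :: 'f \<Rightarrow> ('a \<Rightarrow>\<^sub>0 'f) \<Rightarrow> _" by (rule vector_space_free_scale)
  have vs: "vector_space ((*) :: 'f \<Rightarrow> _)"
    by unfold_locales (auto simp: algebra_simps)
  let ?f = "\<lambda>a. free_lift (*) (\<lambda>z. if D (Some z) (Some a) < D x y then 1 else 0 :: 'f)"
  have diff: "?f a (u - w) = ?f a u - ?f a w" for a u w
  proof -
    interpret f: Vector_Spaces.linear free_scale "(*)" "?f a"
      by (rule linear_free_lift[OF vs])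
    show ?thesis by (rule f.diff)
  qed
  show ?thesis
  proof (cases "x = y")
    case True
    have "(\<lambda>u. if u \<in> UNIV then 0 else 0) \<in> subextensions v"
      by (intro step_in_subextensions assms) (auto simp: F.subspace_UNIV)
    with True show ?thesis by (auto simp: refl)
  next
    case False
    then have r: "0 < D x y" by (rule pos)
    \<comment> \<open>The ball must not contain the zero vector. As \<open>D x y\<close> is at most
      the larger of the distances of \<open>x\<close> and \<open>y\<close> to \<open>None\<close>,
      one of them can serve as centre.\<close>
    have "(\<exists>a. x = Some a \<and> D x y \<le> D x None) \<or> (\<exists>a. y = Some a \<and> D x y \<le> D y None)"
      using ultra[of x y None] sym[of y None] sym[of x y] r refl[of None]
      by (cases x; cases y) (auto simp: max_def split: if_splits)
    then obtain a where a: "D x y \<le> D (Some a) None" "x = Some a \<or> y = Some a"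
      by blast
    note f = ball_functional[OF assms a(1) less_imp_le[OF r]]
    have "?f a (free_emb x - free_emb y) \<noteq> 0"
      unfolding diff f(2) using a(2) r sym[of x y] by (auto simp: refl)
    with f(1) show ?thesis by (intro bexI[of _ "\<lambda>u. if ?f a u = 0 then 0 else D x y"]) auto
  qed
qed

section \<open>Existence of the Kantorovich ultra-seminorm as a supremum\<close>

lemma ultra_seminorm_SUP_subextensions:
  assumes "NA_valuation v" "subextensions v \<noteq> {}"
  shows "ultra_seminorm v free_scale (\<lambda>u. SUP p\<in>subextensions v. p u)"
proof -
  let ?N = "\<lambda>u. SUP p\<in>subextensions v. p u"
  have up: "p u \<le> ?N u" if "p \<in> subextensions v" for p u
    using cSUP_upper[OF that bdd_above_subextensions[OF assms(1)]] .
  have s: "ultra_seminorm v free_scale p" if "p \<in> subextensions v" for p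
    using that by (simp add: subextensions_def)
  have nn: "0 \<le> ?N u" for u
    using assms(2) up s unfolding ultra_seminorm_def by (meson all_not_in_conv order_trans)
  have zero: "?N 0 = 0"
  proof -
    have "?N 0 = (SUP p\<in>subextensions v. 0)"
      using s by (intro SUP_cong) (auto simp: ultra_seminorm_def)
    then show ?thesis using assms(2) by simp
  qed
  moreover have "?N (u + w) \<le> max (?N u) (?N w)" for u w
  proof (rule cSUP_least[OF assms(2)])
    fix p assume p: "p \<in> subextensions v"
    then have "p (u + w) \<le> max (p u) (p w)"
      using s unfolding ultra_seminorm_def by blast
    also have "\<dots> \<le> max (?N u) (?N w)"
      using up[OF p] by (intro max.mono)
    finally show "p (u + w) \<le> max (?N u) (?N w)" .
  qed
  moreover have "?N (free_scale a u) = v a * ?N u" for a u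
  proof (rule antisym)
    show "?N (free_scale a u) \<le> v a * ?N u"
    proof (rule cSUP_least[OF assms(2)])
      fix p assume "p \<in> subextensions v"
      then show "p (free_scale a u) \<le> v a * ?N u"
        using s[of p] up[of p u] assms(1)
        by (auto simp: ultra_seminorm_def NA_valuation_def intro: mult_left_mono)
    qed
    show "v a * ?N u \<le> ?N (free_scale a u)"
    \<comment> \<open>For \<open>v a\<close> nonzero each \<open>p u\<close> equals
      \<open>p (free_scale a u) / v a\<close>, which bounds the supremum; otherwise no division is
      possible, but the left side is 0.\<close>
    proof (cases "v a = 0")
      case True
      then show ?thesis using nn by simp
    next
      case False
      then have "0 < v a" using assms(1) by (simp add: NA_valuation_def less_le)
      have "?N u \<le> ?N (free_scale a u) / v a"
      proof (rule cSUP_least[OF assms(2)])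
        fix p assume "p \<in> subextensions v"
        then show "p u \<le> ?N (free_scale a u) / v a"
          using s[of p] up[of p "free_scale a u"] \<open>0 < v a\<close>
          by (simp add: ultra_seminorm_def field_simps)
      qed
      then show ?thesis using \<open>0 < v a\<close> by (simp add: field_simps)
    qed
  qed
  ultimately show ?thesis
    using nn by (simp add: ultra_seminorm_def)
qed

text \<open>Each value \<open>D x y\<close> is attained by some member, so the supremum restricts to
  \<open>D\<close>; every ultra-seminorm restricting to \<open>D\<close> is a member, so none
  exceeds it. Hence the \<open>GREATEST\<close> in the definition of \<open>kantorovich\<close>
  exists.\<close>

lemma kantorovich_eq_SUP:
  assumes "NA_valuation v" "trivial_valuation v"
  shows "kantorovich v D = (\<lambda>u. SUP p\<in>subextensions v. p u)"
  unfolding kantorovich_def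
proof (rule Greatest_equality, intro conjI allI)
  have ne: "subextensions v \<noteq> {}"
    using subextension_attains[OF assms] by blast
  then show "ultra_seminorm v free_scale (\<lambda>u. SUP p\<in>subextensions v. p u)"
    by (rule ultra_seminorm_SUP_subextensions[OF assms(1)])
  fix x y
  show "(SUP p\<in>subextensions v. p (free_emb x - free_emb y)) = D x y"
  proof (rule antisym)
    show "(SUP p\<in>subextensions v. p (free_emb x - free_emb y)) \<le> D x y"
      by (rule cSUP_least[OF ne]) (simp add: subextensions_def)
    show "D x y \<le> (SUP p\<in>subextensions v. p (free_emb x - free_emb y))"
      using subextension_attains[OF assms, of x y]
      by (auto intro: cSUP_upper2[OF bdd_above_subextensions[OF assms(1)]])
  qed
next
  fix p :: "('a \<Rightarrow>\<^sub>0 'b) \<Rightarrow> real"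
  assume "ultra_seminorm v free_scale p \<and> (\<forall>x y. p (free_emb x - free_emb y) = D x y)"
  then have "p \<in> subextensions v" by (simp add: subextensions_def)
  then show "p \<le> (\<lambda>u. SUP p\<in>subextensions v. p u)"
    by (intro le_funI cSUP_upper bdd_above_subextensions[OF assms(1)])
qed

lemma subextension_le_kantorovich:
  assumes "NA_valuation v" "trivial_valuation v" "p \<in> subextensions v"
  shows "p u \<le> kantorovich v D u"
  unfolding kantorovich_eq_SUP[OF assms(1,2)]
  by (rule cSUP_upper[OF assms(3) bdd_above_subextensions[OF assms(1)]])

lemma ultra_seminorm_kantorovich:
  assumes "NA_valuation v" "trivial_valuation v"
  shows "ultra_seminorm v free_scale (kantorovich v D)"
proof -
  have "subextensions v \<noteq> {}"
    using subextension_attains[OF assms] by blast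
  then show ?thesis
    unfolding kantorovich_eq_SUP[OF assms] by (rule ultra_seminorm_SUP_subextensions[OF assms(1)])
qed

lemma kantorovich_emb_le:
  assumes "NA_valuation v" "trivial_valuation v"
  shows "kantorovich v D (free_emb x - free_emb y) \<le> D x y"
proof -
  have "subextensions v \<noteq> {}"
    using subextension_attains[OF assms] by blast
  then show ?thesis
    unfolding kantorovich_eq_SUP[OF assms]
    by (rule cSUP_least) (simp add: subextensions_def)
qed

text \<open>A ball around a point of the support, small enough to avoid the rest of the support,
  separates a nonzero vector from zero.\<close>

lemma ultra_norm_kantorovich:
  fixes v :: "'f::field \<Rightarrow> real"
  assumes "NA_valuation v" "trivial_valuation v"
  shows "ultra_norm v free_scale (kantorovich v D)"
proof -
  have "0 < kantorovich v D u" if "u \<noteq> 0" for u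
  proof -
    have "Poly_Mapping.keys u \<noteq> {}" using that by simp
    then obtain a where a: "a \<in> Poly_Mapping.keys u" by blast
    \<comment> \<open>The distance to \<open>None\<close> is listed so that
      \<open>ball_functional\<close> applies, the others so that the ball of radius \<open>r\<close>
      meets the support in \<open>a\<close> alone and its functional reads off the coefficient of
      \<open>a\<close>.\<close>
    define R where
      "R = insert (D (Some a) None) ((\<lambda>y. D (Some y) (Some a)) ` (Poly_Mapping.keys u - {a}))"
    have R: "finite R" "R \<noteq> {}" by (auto simp: R_def)
    define r where "r = Min R"
    have "0 < r" using R pos by (auto simp: r_def R_def)
    have r: "r \<le> D (Some a) None" "\<And>y. y \<in> Poly_Mapping.keys u - {a} \<Longrightarrow> r \<le> D (Some y) (Some a)"
      using Min_le[OF R(1)] by (auto simp: r_def R_def)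
    let ?f = "free_lift (*) (\<lambda>x. if D (Some x) (Some a) < r then 1 else 0 :: 'f)"
    have "?f u = (\<Sum>x\<in>Poly_Mapping.keys u. if x = a then Poly_Mapping.lookup u x else 0)"
      unfolding free_lift_def using \<open>0 < r\<close> r(2)
      by (intro sum.cong) (force simp: refl)+
    then have "?f u \<noteq> 0" using a by (simp add: in_keys_iff)
    then have "r \<le> kantorovich v D u"
      using subextension_le_kantorovich[OF assms
          ball_functional(1)[OF assms r(1) less_imp_le[OF \<open>0 < r\<close>]], of u]
      by simp
    then show ?thesis using \<open>0 < r\<close> by simp
  qed
  then show ?thesis
    using ultra_seminorm_kantorovich[OF assms] by (force simp: ultra_norm_def)
qed

text \<open>The step function of height \<open>\<delta>\<close> off
  \<open>{u. q (\<Phi> u) < e}\<close> is a subextension, hence at most the Kantorovich norm; a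
  vector of norm below \<open>\<delta>\<close> must lie where the step is 0. An estimate on pairs of
  points thus becomes continuity at zero.\<close>

lemma kantorovich_controls:
  assumes "NA_valuation v" "trivial_valuation v"
    and "ultra_seminorm v s q" "Vector_Spaces.linear free_scale s \<Phi>" "0 < e" "0 < \<delta>"
    and "\<And>x y. D x y < \<delta> \<Longrightarrow> q (\<Phi> (free_emb x - free_emb y)) < e"
    and "kantorovich v D u < \<delta>"
  shows "q (\<Phi> u) < e"
proof -
  have "(\<lambda>u. if u \<in> {u. q (\<Phi> u) < e} then 0 else \<delta>) \<in> subextensions v"
    using assms by (intro step_in_subextensions subspace_ultra_seminorm_less[of v s]) auto
  from subextension_le_kantorovich[OF assms(1,2) this, of u] assms(8) show ?thesis
    by (auto split: if_splits)
qed

end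

section \<open>The free NA locally convex space of an ultra-metric space\<close>

text \<open>The relations \<open>dist x y < e\<close> are transitive by the strong triangle
  inequality and form a base; the one of radius \<open>dist x y\<close> excludes the pair
  itself.\<close>

lemma Hausdorff_NA_uniformity_ultrametric:
  assumes ultra: "\<And>x y z :: 'a::metric_space. dist x z \<le> max (dist x y) (dist y z)"
  shows "Hausdorff_NA_uniformity (uniformity :: ('a \<times> 'a) filter)"
  unfolding Hausdorff_NA_uniformity_def
proof (intro conjI allI impI)
  fix E :: "'a \<times> 'a \<Rightarrow> bool"
  assume "eventually E uniformity"
  then obtain e where e: "e > 0" "\<And>x y. dist x y < e \<Longrightarrow> E (x, y)"
    by (auto simp: eventually_uniformity_metric)
  have "equiv UNIV {(x, y :: 'a). dist x y < e}"
  proof (rule equivI)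
    show "trans {(x, y :: 'a). dist x y < e}"
      using ultra by (fastforce intro!: transI simp: le_max_iff_disj dest: le_less_trans)
  qed (use e(1) in \<open>auto simp: refl_on_def sym_def dist_commute\<close>)
  moreover have "eventually (\<lambda>z. z \<in> {(x, y :: 'a). dist x y < e}) uniformity"
    using e(1) by (auto simp: eventually_uniformity_metric)
  ultimately show "\<exists>R. equiv UNIV R \<and> eventually (\<lambda>z. z \<in> R) uniformity \<and> (\<forall>z\<in>R. E z)"
    using e(2) by blast
next
  fix x y :: 'a
  assume "x \<noteq> y"
  then show "\<exists>E. eventually E uniformity \<and> \<not> E (x, y)"
    by (intro exI[of _ "\<lambda>(a, b). dist a b < dist x y"])
      (auto simp: eventually_uniformity_metric intro!: exI[of _ "dist x y"])
qed

text \<open>Additive entourages come from neighbourhoods of 0 pulled back under subtraction, so the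
  filter statement becomes an epsilon-delta condition at 0.\<close>

lemma uniformly_continuous_map_additive_iff:
  fixes f :: "'a::metric_space \<Rightarrow> 'v::ab_group_add"
  assumes "topspace T = UNIV"
  shows "uniformly_continuous_map uniformity (additive_uniformity T) f \<longleftrightarrow>
    (\<forall>U. openin T U \<longrightarrow> 0 \<in> U \<longrightarrow> (\<exists>\<delta>>0. \<forall>x y. dist x y < \<delta> \<longrightarrow> f x - f y \<in> U))"
proof -
  have "uniformly_continuous_map uniformity (additive_uniformity T) f \<longleftrightarrow>
    (\<forall>P. (\<exists>S. openin T S \<and> 0 \<in> S \<and> (\<forall>z\<in>S. P z)) \<longrightarrow>
         (\<exists>\<delta>>0. \<forall>x y. dist x y < \<delta> \<longrightarrow> P (f x - f y)))"
    unfolding uniformly_continuous_map_def additive_uniformity_def filterlim_filtercomap_iff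
    unfolding filterlim_iff eventually_nhdsin eventually_uniformity_metric
    using assms by (simp add: o_def case_prod_unfold)
  also have "\<dots> \<longleftrightarrow>
    (\<forall>U. openin T U \<longrightarrow> 0 \<in> U \<longrightarrow> (\<exists>\<delta>>0. \<forall>x y. dist x y < \<delta> \<longrightarrow> f x - f y \<in> U))"
    (is "?L \<longleftrightarrow> ?R")
  proof
    assume L: ?L
    show ?R
      using L[rule_format, of "\<lambda>z. z \<in> _"] by blast
  next
    assume ?R
    then show ?L by meson
  qed
  finally show ?thesis .
qed

lemma pointed_ultrametric_extended_dist:
  fixes x0 :: "'a::metric_space"
  assumes ultra: "\<And>x y z :: 'a. dist x z \<le> max (dist x y) (dist y z)"
  shows "pointed_ultrametric (extended_dist dist x0)"
proof
  fix x y z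
  show "extended_dist dist x0 x x = 0" by (cases x) auto
  show "x \<noteq> y \<Longrightarrow> 0 < extended_dist dist x0 x y" by (cases x; cases y) auto
  show "extended_dist dist x0 x y = extended_dist dist x0 y x"
    by (cases x; cases y) (auto simp: dist_commute)
  \<comment> \<open>These are the triangles whose middle, last or first vertex alone is the zero
    vector; each reduces to the strong triangle inequality among \<open>a\<close>, \<open>b\<close>
    and \<open>x0\<close>.\<close>
  have "dist a b \<le> max (max (dist a x0) 1) (max (dist b x0) 1)"
    "max (dist a x0) 1 \<le> max (dist a b) (max (dist b x0) 1)"
    "max (dist b x0) 1 \<le> max (max (dist a x0) 1) (dist a b)" for a b
    using ultra[of a b x0] ultra[of a x0 b] ultra[of b x0 a] by (auto simp: dist_commute)
  then show "extended_dist dist x0 x z \<le> max (extended_dist dist x0 x y) (extended_dist dist x0 y z)"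
    using ultra by (cases x; cases y; cases z) (auto simp: le_max_iff_disj)
qed

section \<open>The universal property for the Kantorovich topology\<close>

lemma free_NA_lcs_kantorovich:
  fixes v :: "'f::field \<Rightarrow> real" and x0 :: "'a::metric_space"
  assumes v: "NA_valuation v" "trivial_valuation v"
    and ultra: "\<And>x y z :: 'a. dist x z \<le> max (dist x y) (dist y z)"
  shows "free_NA_lcs TYPE('v::ab_group_add) v (uniformity :: ('a \<times> 'a) filter)
           (seminorm_topology {kantorovich v (extended_dist dist x0)})"
proof -
  interpret pointed_ultrametric "extended_dist dist x0"
    using ultra by (rule pointed_ultrametric_extended_dist)
  let ?D = "extended_dist dist x0"
  let ?N = "kantorovich v ?D"
  let ?T = "seminorm_topology {?N}"
  note N = ultra_seminorm_kantorovich[OF v]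
  have uc: "uniformly_continuous_map uniformity (additive_uniformity ?T) free_gen"
    unfolding uniformly_continuous_map_additive_iff[OF topspace_seminorm_topology]
  proof (intro allI impI)
    fix U assume "openin ?T U" "0 \<in> U"
    then obtain e where e: "e > 0" "\<And>y. ?N (y - 0) < e \<Longrightarrow> y \<in> U"
      unfolding openin_seminorm_topology_singleton[OF N] by blast
    have "?N (free_gen x - free_gen y) \<le> dist x y" for x y
      using kantorovich_emb_le[OF v, of "Some x" "Some y"] by simp
    then have "\<forall>x y. dist x y < e \<longrightarrow> free_gen x - free_gen y \<in> U"
      using e(2) le_less_trans unfolding diff_zero by blast
    with e(1) show "\<exists>\<delta>>0. \<forall>x y. dist x y < \<delta> \<longrightarrow> free_gen x - free_gen y \<in> U" by blast
  qed
  have univ: "\<exists>!\<Phi>. Vector_Spaces.linear free_scale s \<Phi> \<and> (\<forall>x. \<Phi> (free_gen x) = \<phi> x) \<and>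
              continuous_map ?T S \<Phi>"
    if S: "NA_locally_convex_space v s S"
      and \<phi>: "uniformly_continuous_map uniformity (additive_uniformity S) \<phi>"
    for s :: "'f \<Rightarrow> 'v \<Rightarrow> 'v" and S and \<phi> :: "'a \<Rightarrow> 'v"
  proof -
    have vs: "vector_space s"
      using S by (simp add: NA_locally_convex_space_def topological_vector_space_def)
    obtain P where P: "\<And>p. p \<in> P \<Longrightarrow> ultra_seminorm v s p" and S_eq: "S = seminorm_topology P"
      using S unfolding NA_locally_convex_space_def by blast
    let ?\<Phi> = "free_lift s \<phi>"
    interpret lin: Vector_Spaces.linear free_scale s ?\<Phi>
      by (rule linear_free_lift[OF vs])
    have lin: "Vector_Spaces.linear free_scale s ?\<Phi>" ..
    have "continuous_map ?T S ?\<Phi>"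
      unfolding S_eq
    proof (rule continuous_map_into_seminorm_topology)
      fix q z and e :: real assume q: "q \<in> P" and e: "0 < e"
      have "openin S {y. q (y - 0) < e}" "0 \<in> {y. q (y - 0) < e}"
        using openin_seminorm_ball[OF q e, of 0] P[OF q] e by (auto simp: S_eq ultra_seminorm_def)
      then obtain \<delta> where \<delta>: "\<delta> > 0" "\<And>x y. dist x y < \<delta> \<Longrightarrow> q (\<phi> x - \<phi> y) < e"
        using \<phi> uniformly_continuous_map_additive_iff[of S \<phi>] by (force simp: S_eq)
      \<comment> \<open>Capping at 1 excludes the pairs with exactly one zero vector, whose distance is at least 1.\<close>
      define \<delta>' where "\<delta>' = min \<delta> 1"
      have emb: "q (?\<Phi> (free_emb x - free_emb y)) < e" if "?D x y < \<delta>'" for x y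
        using that \<delta> e P[OF q]
        by (cases x; cases y)
          (auto simp: \<delta>'_def lin.diff free_lift_gen[OF vs] lin.zero ultra_seminorm_def)
      have small: "q (?\<Phi> u) < e" if "?N u < \<delta>'" for u
        using kantorovich_controls[OF v P[OF q] lin e _ emb that] \<delta>(1) by (simp add: \<delta>'_def)
      \<comment> \<open>By linearity the images of \<open>w\<close> and \<open>u\<close> differ by
        the image of \<open>w - u\<close>, so the estimate at zero carries over to every point with
        the same \<open>e\<close>.\<close>
      have "q (?\<Phi> w - z) < e" if "q (?\<Phi> u - z) < e" "?N (w - u) < \<delta>'" for u w
        using ultra_seminorm_diff_less[OF P[OF q] _ that(1)] small[OF that(2)] by (simp add: lin.diff)
      then show "openin ?T {x \<in> topspace ?T. q (?\<Phi> x - z) < e}"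
        unfolding openin_seminorm_topology_singleton[OF N]
        using \<delta>(1) by (auto simp: \<delta>'_def intro!: exI[of _ "min \<delta> 1"])
    qed
    then have ex: "Vector_Spaces.linear free_scale s ?\<Phi> \<and> (\<forall>x. ?\<Phi> (free_gen x) = \<phi> x) \<and>
        continuous_map ?T S ?\<Phi>"
      by (intro conjI allI lin free_lift_gen[OF vs])
    have unique: "\<Psi> = ?\<Phi>"
      if "Vector_Spaces.linear free_scale s \<Psi>" "\<forall>x. \<Psi> (free_gen x) = \<phi> x" for \<Psi>
      using that by (intro linear_eq_free_lift) auto
    show ?thesis
      by (rule ex1I, rule ex) (elim conjE, rule unique)
  qed
  show ?thesis
    unfolding free_NA_lcs_def
    by (intro conjI allI impI Hausdorff_NA_uniformity_ultrametric[OF assms(3)] uc univ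
        NA_locally_convex_space_ultra_norm[OF v vector_space_free_scale ultra_norm_kantorovich[OF v]])
qed

section \<open>Uniqueness of the free topology\<close>

lemma free_NA_lcs_finer:
  fixes T T' :: "('a \<Rightarrow>\<^sub>0 'f::field) topology"
  assumes "free_NA_lcs TYPE('a \<Rightarrow>\<^sub>0 'f) v U T" "NA_locally_convex_space v free_scale T'"
    and "uniformly_continuous_map U (additive_uniformity T') free_gen"
  shows "continuous_map T T' (\<lambda>u. u)"
proof -
  obtain \<Phi> where \<Phi>: "Vector_Spaces.linear free_scale free_scale \<Phi>"
    "\<forall>x. \<Phi> (free_gen x) = free_gen x" "continuous_map T T' \<Phi>"
    using assms unfolding free_NA_lcs_def by blast
  \<comment> \<open>The linear extension of the canonical map is the identity, so continuity of
    \<open>\<Phi>\<close> says that \<open>T\<close> is finer than \<open>T'\<close>.\<close>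
  have "\<Phi> = (\<lambda>u. u)"
    using linear_eq_free_lift[OF \<Phi>(1) \<Phi>(2)[rule_format]]
    by (simp add: fun_eq_iff free_lift_free_gen)
  with \<Phi>(3) show ?thesis by simp
qed

lemma free_NA_lcs_unique:
  fixes T T' :: "('a \<Rightarrow>\<^sub>0 'f::field) topology"
  assumes "free_NA_lcs TYPE('a \<Rightarrow>\<^sub>0 'f) v U T" "free_NA_lcs TYPE('a \<Rightarrow>\<^sub>0 'f) v U T'"
  shows "T = T'"
proof -
  have top: "topspace T = UNIV" "topspace T' = UNIV"
    using assms
    by (simp_all add: free_NA_lcs_def NA_locally_convex_space_def topological_vector_space_def)
  have "continuous_map T T' (\<lambda>u. u)" "continuous_map T' T (\<lambda>u. u)"
    using assms by (auto intro!: free_NA_lcs_finer simp: free_NA_lcs_def)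
  then show ?thesis
    using top by (auto simp: topology_eq continuous_map_def)
qed

text \<open>The type \<open>'v\<close> of the test spaces is arbitrary in the second conjunct. The
  third assumes the universal property only for test spaces on the free vector space itself, which
  already determines \<open>T\<close>.\<close>

theorem theorem6p5:
  fixes v :: "'f::field \<Rightarrow> real" and x0 :: "'a::metric_space"
  assumes "NA_valuation v" and "trivial_valuation v"
    and ultra: "\<And>x y z :: 'a. dist x z \<le> max (dist x y) (dist y z)"
  defines "N \<equiv> kantorovich v (extended_dist dist x0)"
  shows "ultra_norm v free_scale N \<and>
         free_NA_lcs TYPE('v::ab_group_add) v (uniformity :: ('a \<times> 'a) filter)
           (seminorm_topology {N}) \<and>
         (\<forall>T. free_NA_lcs TYPE('a \<Rightarrow>\<^sub>0 'f) v (uniformity :: ('a \<times> 'a) filter) T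
              \<longrightarrow> T = seminorm_topology {N})"
proof -
  interpret pointed_ultrametric "extended_dist dist x0"
    using ultra by (rule pointed_ultrametric_extended_dist)
  show ?thesis
    unfolding N_def
    by (intro conjI allI impI ultra_norm_kantorovich[OF assms(1,2)]
        free_NA_lcs_kantorovich[OF assms(1-3)])
      (erule free_NA_lcs_unique[OF _ free_NA_lcs_kantorovich[OF assms(1-3)]])
qed

end
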